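(* Let $M\le\dim\mathrm{sym}(\mathbb{H}^{N\times N})$. The set of all unit norm frames $\{\phi_i\}_{i=1}^M$ for $\mathbb{H}^N$ for which the induced outer products $\{\phi_i\phi_i^*\}_{i=1}^M$ are linearly independent is open and dense in the family of all unit norm $M$-element frames for $\mathbb{H}^N$, with respect to the metric $d(\Phi,\Psi)=\sqrt{\sum_{i=1}^M\|\phi_i-\psi_i\|^2}$, where $\Phi=\{\phi_i\}_{i=1}^M$ and $\Psi=\{\psi_i\}_{i=1}^M$.
   Context: $\mathbb{H}$ denotes $\mathbb{R}$ or $\mathbb{C}$. $\mathrm{sym}(\mathbb{H}^{N\times N})$ is the real vector space of self-adjoint $N\times N$ matrices over $\mathbb{H}$; its (real) dimension is $N(N+1)/2$ if $\mathbb{H}=\mathbb{R}$ and $N^2$ if $\mathbb{H}=\mathbb{C}$. A frame for the finite-dimensional space $\mathbb{H}^N$ is a finite spanning sequence $\{\phi_i\}_{i=1}^M$; it is unit norm if $\|\phi_i\|=1$ for all $i$. Such frames are regarded as points of the $M$-fold product of the unit sphere $S_{N-1}$ of $\mathbb{H}^N$, with the Euclidean subspace topology. *)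

theory Defs
  imports "HOL-Analysis.Analysis"
begin

text \<open>
  The scalars are \<open>real\<close> or \<open>complex\<close>, and the space of vectors is \<open>'a ^ 'n\<close> with \<open>N = CARD('n)\<close>;
  its norm is the Euclidean one. The parameter \<open>cj\<close> is the conjugation of the scalars, \<open>id\<close> for
  \<open>real\<close> and \<open>cnj\<close> for \<open>complex\<close>.
\<close>

definition adjoint_matrix :: "('a \<Rightarrow> 'a) \<Rightarrow> 'a ^ 'n ^ 'n \<Rightarrow> 'a ^ 'n ^ 'n" where
  "adjoint_matrix cj A = (\<chi> i j. cj (A $ j $ i))"

definition sym_matrices :: "('a \<Rightarrow> 'a) \<Rightarrow> ('a ^ 'n ^ 'n) set" where
  "sym_matrices cj = {A. adjoint_matrix cj A = A}"

definition outer_product :: "('a \<Rightarrow> 'a) \<Rightarrow> 'a::times ^ 'n \<Rightarrow> 'a ^ 'n ^ 'n" where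
  "outer_product cj v = (\<chi> i j. v $ i * cj (v $ j))"

text \<open>
  A sequence of length \<open>M\<close> is a function on \<open>{1..M}\<close>, made extensional so that two sequences with
  the same entries are equal. Spanning (\<open>vec.span\<close>) is over the scalar field \<open>'a\<close>.
\<close>

definition is_frame :: "nat \<Rightarrow> (nat \<Rightarrow> 'a::field ^ 'n) \<Rightarrow> bool" where
  "is_frame M \<Phi> \<longleftrightarrow> \<Phi> \<in> extensional {1..M} \<and> vec.span (\<Phi> ` {1..M}) = UNIV"

definition unit_norm_frames :: "nat \<Rightarrow> (nat \<Rightarrow> 'a::real_normed_field ^ 'n) set" where
  "unit_norm_frames M = {\<Phi>. is_frame M \<Phi> \<and> (\<forall>i\<in>{1..M}. norm (\<Phi> i) = 1)}"

text \<open>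
  Linear independence of an indexed family, so that a repeated entry makes it dependent. It is
  taken over the reals, since the self-adjoint matrices form a real vector space.
\<close>

definition independent_family :: "'i set \<Rightarrow> ('i \<Rightarrow> 'b::real_vector) \<Rightarrow> bool" where
  "independent_family I f \<longleftrightarrow> inj_on f I \<and> independent (f ` I)"

definition independent_outer_frames ::
    "('a \<Rightarrow> 'a) \<Rightarrow> nat \<Rightarrow> (nat \<Rightarrow> 'a::real_normed_field ^ 'n) set" where
  "independent_outer_frames cj M =
     {\<Phi> \<in> unit_norm_frames M. independent_family {1..M} (\<lambda>i. outer_product cj (\<Phi> i))}"

definition frame_dist ::
    "nat \<Rightarrow> (nat \<Rightarrow> 'a::real_normed_vector) \<Rightarrow> (nat \<Rightarrow> 'a) \<Rightarrow> real" where
  "frame_dist M \<Phi> \<Psi> = sqrt (\<Sum>i=1..M. (norm (\<Phi> i - \<Psi> i))\<^sup>2)"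

lemma Metric_space_unit_norm_frames:
  "Metric_space (unit_norm_frames M :: (nat \<Rightarrow> 'a::real_normed_field ^ 'n) set) (frame_dist M)"
proof
  fix x y :: "nat \<Rightarrow> 'a ^ 'n"
  show "0 \<le> frame_dist M x y"
    by (simp add: frame_dist_def sum_nonneg)
  show "frame_dist M x y = frame_dist M y x"
    by (simp add: frame_dist_def norm_minus_commute)
next
  fix x y :: "nat \<Rightarrow> 'a ^ 'n"
  assume "x \<in> unit_norm_frames M" "y \<in> unit_norm_frames M"
  then have ext: "x \<in> extensional {1..M}" "y \<in> extensional {1..M}"
    by (auto simp: unit_norm_frames_def is_frame_def)
  have "frame_dist M x y = 0 \<longleftrightarrow> (\<forall>i\<in>{1..M}. x i = y i)"
    by (simp add: frame_dist_def sum_nonneg_eq_0_iff)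
  also have "\<dots> \<longleftrightarrow> x = y"
    using ext by (metis extensionalityI)
  finally show "frame_dist M x y = 0 \<longleftrightarrow> x = y" .
next
  fix x y z :: "nat \<Rightarrow> 'a ^ 'n"
  have "frame_dist M x z = L2_set (\<lambda>i. norm (x i - z i)) {1..M}"
    by (simp add: frame_dist_def L2_set_def)
  also have "\<dots> \<le> L2_set (\<lambda>i. norm (x i - y i) + norm (y i - z i)) {1..M}"
    by (intro L2_set_mono) (auto intro: norm_diff_triangle_le)
  also have "\<dots> \<le> L2_set (\<lambda>i. norm (x i - y i)) {1..M} + L2_set (\<lambda>i. norm (y i - z i)) {1..M}"
    by (rule L2_set_triangle_ineq)
  finally show "frame_dist M x z \<le> frame_dist M x y + frame_dist M y z"
    by (simp add: frame_dist_def L2_set_def)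
qed

abbreviation frame_topology :: "nat \<Rightarrow> (nat \<Rightarrow> 'a::real_normed_field ^ 'n) topology" where
  "frame_topology M \<equiv> Metric_space.mtopology (unit_norm_frames M) (frame_dist M)"

end

theory Submission
  imports Defs
begin

text \<open>
  Openness says that a linearly independent finite family stays independent under small
  perturbations (\<open>eventually_independent_family\<close>), applied to the outer products, which depend
  continuously on the vectors.

  For density, the vectors of a given frame are moved slightly one after the other, so that each
  new outer product avoids the span \<open>S\<close> of those already chosen. Fewer than \<open>M\<close> matrices span
  \<open>S\<close>, and \<open>M\<close> is at most the dimension of the space of self-adjoint matrices, so \<open>S\<close> does not
  contain all of them, and it suffices that the outer products
  of the unit vectors near a given unit vector \<open>\<phi>\<close> span that space. Write \<open>u\<^sup>*\<close> for the conjugate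
  transpose. Since \<open>(c u) (c u)\<^sup>* = c\<^sup>2 u u\<^sup>*\<close> for real \<open>c\<close>, a subspace containing those
  outer products contains the outer product of every vector near \<open>\<phi>\<close>, of unit norm or not. The
  parallelogram identity
  \<open>(\<phi> + t w) (\<phi> + t w)\<^sup>* + (\<phi> - t w) (\<phi> - t w)\<^sup>* = 2 \<phi> \<phi>\<^sup>* + 2 t\<^sup>2 w w\<^sup>*\<close>
  for small \<open>t > 0\<close> then puts \<open>w w\<^sup>*\<close> into the subspace for every \<open>w\<close>, and the matrices \<open>w w\<^sup>*\<close>
  span the self-adjoint ones by polarization. A sufficiently small perturbation of a frame is
  still a frame (\<open>eventually_spanning\<close>).

  The argument is the same over both scalar fields; the locale \<open>conjugation\<close> abstracts from the
  choice between them.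
\<close>

section \<open>Stability of linear independence and of spanning\<close>

lemma independent_familyI:
  assumes "finite I"
    and zero: "\<And>a k. (\<Sum>i\<in>I. a i *\<^sub>R f i) = 0 \<Longrightarrow> k \<in> I \<Longrightarrow> a k = 0"
  shows "independent_family I f"
  unfolding independent_family_def
proof
  show inj: "inj_on f I"
  proof (rule inj_onI, rule ccontr)
    fix i j assume ij: "i \<in> I" "j \<in> I" "f i = f j" "i \<noteq> j"
    have "(\<Sum>k\<in>I. (of_bool (k = i) - of_bool (k = j)) *\<^sub>R f k)
        = (\<Sum>k\<in>I. of_bool (k = i) *\<^sub>R f k) - (\<Sum>k\<in>I. of_bool (k = j) *\<^sub>R f k)"
      by (simp add: scaleR_diff_left sum_subtractf)
    also have "\<dots> = 0"
      using ij \<open>finite I\<close> by (simp add: of_bool_def if_distrib[of "\<lambda>c. c *\<^sub>R _"] cong: if_cong)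
    finally have "of_bool (i = i) - of_bool (i = j) = (0::real)"
      using zero[of "\<lambda>k. of_bool (k = i) - of_bool (k = j)" i] ij by simp
    with ij show False by simp
  qed
  show "independent (f ` I)"
  proof (rule independent_if_scalars_zero)
    fix u x assume "(\<Sum>y\<in>f ` I. u y *\<^sub>R y) = 0" "x \<in> f ` I"
    then show "u x = 0"
      using zero[of "\<lambda>i. u (f i)"] by (auto simp: sum.reindex[OF inj])
  qed (use \<open>finite I\<close> in simp)
qed

lemma independent_family_cong:
  assumes "\<And>i. i \<in> I \<Longrightarrow> f i = g i"
  shows "independent_family I f \<longleftrightarrow> independent_family I g"
  by (simp add: independent_family_def assms cong: inj_on_cong image_cong)

lemma independent_family_insert:
  assumes "independent_family I f" "f i \<notin> span (f ` I)"
  shows "independent_family (insert i I) f"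
proof -
  have "f i \<notin> f ` I"
    using assms(2) span_base[of "f i" "f ` I"] by auto
  then show ?thesis
    using assms by (auto simp: independent_family_def independent_insertI)
qed

text \<open>
  Let \<open>g\<^sub>k\<close> be linear functionals dual to the \<open>v\<^sub>i\<close>. Near the limit the matrix with entries
  \<open>g\<^sub>k (w\<^sub>i)\<close> is so close to the identity that it is strictly diagonally dominant: applying \<open>g\<^sub>k\<close> to a
  relation between the \<open>w\<^sub>i\<close>, where \<open>k\<close> is the index of the largest coefficient, forces that
  coefficient to vanish. Convergence along an arbitrary filter serves both sequences of frames and
  metric neighbourhoods of a frame.
\<close>

lemma eventually_independent_family:
  fixes v :: "'i \<Rightarrow> 'b::euclidean_space" and w :: "'t \<Rightarrow> 'i \<Rightarrow> 'b"
  assumes "finite I" and v: "independent_family I v"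
    and lim: "\<And>i. i \<in> I \<Longrightarrow> ((\<lambda>t. w t i) \<longlongrightarrow> v i) F"
  shows "\<forall>\<^sub>F t in F. independent_family I (w t)"
proof -
  have inj: "inj_on v I" and ind: "independent (v ` I)"
    using v by (auto simp: independent_family_def)
  have "\<exists>g. linear g \<and> (\<forall>i\<in>I. g (v i) = (of_bool (i = k) :: real))" for k
  proof -
    obtain g :: "'b \<Rightarrow> real" where "linear g"
        "\<forall>x\<in>v ` I. g x = of_bool (the_inv_into I v x = k)"
      using linear_independent_extend[OF ind, of "\<lambda>x. of_bool (the_inv_into I v x = k)"] by auto
    then show ?thesis
      using the_inv_into_f_f[OF inj] by auto
  qed
  then obtain g :: "'i \<Rightarrow> 'b \<Rightarrow> real" where lin: "\<And>k. linear (g k)"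
      and dual: "\<And>k i. i \<in> I \<Longrightarrow> g k (v i) = of_bool (i = k)"
    by metis
  have "\<forall>\<^sub>F t in F. (\<Sum>i\<in>I. \<bar>g k (w t i) - of_bool (i = k)\<bar>) < 1" for k
  proof (rule order_tendstoD(2))
    have "((\<lambda>t. g k (w t i)) \<longlongrightarrow> of_bool (i = k)) F" if "i \<in> I" for i
      using bounded_linear.tendsto[OF linear_linear[THEN iffD2, OF lin] lim[OF that]]
      by (simp add: dual that)
    then have "((\<lambda>t. \<Sum>i\<in>I. \<bar>g k (w t i) - of_bool (i = k)\<bar>) \<longlongrightarrow>
        (\<Sum>i\<in>I. \<bar>of_bool (i = k) - of_bool (i = k)\<bar>)) F"
      by (intro tendsto_intros)
    then show "((\<lambda>t. \<Sum>i\<in>I. \<bar>g k (w t i) - of_bool (i = k)\<bar>) \<longlongrightarrow> 0) F"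
      by simp
  qed simp
  then have "\<forall>\<^sub>F t in F. \<forall>k\<in>I. (\<Sum>i\<in>I. \<bar>g k (w t i) - of_bool (i = k)\<bar>) < 1"
    using \<open>finite I\<close> by (simp add: eventually_ball_finite)
  then show ?thesis
  proof (rule eventually_mono)
    fix t assume small: "\<forall>k\<in>I. (\<Sum>i\<in>I. \<bar>g k (w t i) - of_bool (i = k)\<bar>) < 1"
    show "independent_family I (w t)"
    proof (rule independent_familyI[OF \<open>finite I\<close>])
      fix a j assume rel: "(\<Sum>i\<in>I. a i *\<^sub>R w t i) = 0" and "j \<in> I"
      obtain k where k: "k \<in> I" "\<And>i. i \<in> I \<Longrightarrow> \<bar>a i\<bar> \<le> \<bar>a k\<bar>"
      proof -
        have "Max ((\<lambda>i. \<bar>a i\<bar>) ` I) \<in> (\<lambda>i. \<bar>a i\<bar>) ` I"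
          using \<open>finite I\<close> \<open>j \<in> I\<close> by (intro Max_in) auto
        then obtain k where "k \<in> I" "Max ((\<lambda>i. \<bar>a i\<bar>) ` I) = \<bar>a k\<bar>" by auto
        moreover have "\<bar>a i\<bar> \<le> Max ((\<lambda>i. \<bar>a i\<bar>) ` I)" if "i \<in> I" for i
          using \<open>finite I\<close> that by simp
        ultimately show thesis using that by auto
      qed
      let ?s = "\<Sum>i\<in>I. \<bar>g k (w t i) - of_bool (i = k)\<bar>"
      have "(\<Sum>i\<in>I. a i * g k (w t i)) = g k (\<Sum>i\<in>I. a i *\<^sub>R w t i)"
        by (simp add: linear_sum[OF lin] linear_scale[OF lin])
      also have "\<dots> = 0"
        by (simp add: rel linear_0[OF lin])
      finally have "(\<Sum>i\<in>I. a i * (g k (w t i) - of_bool (i = k))) = - a k"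
        using \<open>finite I\<close> k(1) by (simp add: algebra_simps sum_subtractf of_bool_def
            if_distrib[of "\<lambda>c. _ * c"] cong: if_cong)
      then have "\<bar>a k\<bar> = \<bar>\<Sum>i\<in>I. a i * (g k (w t i) - of_bool (i = k))\<bar>"
        by simp
      also have "\<dots> \<le> (\<Sum>i\<in>I. \<bar>a k\<bar> * \<bar>g k (w t i) - of_bool (i = k)\<bar>)"
        using k(2) by (intro order_trans[OF sum_abs] sum_mono) (simp add: abs_mult mult_right_mono)
      also have "\<dots> = \<bar>a k\<bar> * ?s"
        by (simp add: sum_distrib_left)
      finally have "\<bar>a k\<bar> * (1 - ?s) \<le> 0"
        by (simp add: algebra_simps)
      then have "a k = 0"
        using small k(1) by (auto simp: mult_le_0_iff)
      then show "a j = 0"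
        using k(2)[OF \<open>j \<in> I\<close>] by simp
    qed
  qed
qed

text \<open>
  Writing the standard basis vectors as combinations of the \<open>v\<^sub>i\<close> and replacing \<open>v\<^sub>i\<close> by \<open>w\<^sub>i\<close> in
  them gives the rows of a square matrix close to the identity. Its determinant is a continuous
  function of the \<open>w\<^sub>i\<close>, so near the limit it is nonzero and the rows, which are combinations of
  the \<open>w\<^sub>i\<close>, span.
\<close>

lemma eventually_spanning:
  fixes v :: "'i \<Rightarrow> 'a::real_normed_field ^ 'n" and w :: "'t \<Rightarrow> 'i \<Rightarrow> 'a ^ 'n"
  assumes "finite I" and v: "vec.span (v ` I) = UNIV"
    and lim: "\<And>i. i \<in> I \<Longrightarrow> ((\<lambda>t. w t i) \<longlongrightarrow> v i) F"
  shows "\<forall>\<^sub>F t in F. vec.span (w t ` I) = UNIV"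
proof -
  have "\<exists>c. (\<Sum>i\<in>I. c i *s v i) = x" for x
  proof -
    have "x \<in> vec.span (v ` I)" by (simp add: v)
    then show ?thesis
    proof (induction rule: vec.span_induct_alt)
      case base
      show ?case by (rule exI[of _ "\<lambda>_. 0"]) simp
    next
      case (step c y z)
      then obtain k b where "k \<in> I" "y = v k" "(\<Sum>i\<in>I. b i *s v i) = z" by auto
      then have "(\<Sum>i\<in>I. (b i + (if i = k then c else 0)) *s v i) = c *s y + z"
        using \<open>finite I\<close>
        by (simp add: vec.scale_left_distrib sum.distrib if_distrib[of "\<lambda>c. c *s _"] cong: if_cong)
      then show ?case by (intro exI[of _ "\<lambda>i. b i + (if i = k then c else 0)"])
    qed
  qed
  then have "\<forall>k. \<exists>c. (\<Sum>i\<in>I. c i *s v i) = axis k 1"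
    by simp
  from choice[OF this] obtain c where c: "\<And>k. (\<Sum>i\<in>I. c k i *s v i) = axis k 1"
    by auto
  define A where "A u = (\<chi> k. \<Sum>i\<in>I. c k i *s u i)" for u :: "'i \<Rightarrow> 'a ^ 'n"
  have "A v = mat 1"
    by (simp add: A_def c vec_eq_iff mat_def axis_def)
  have entries: "((\<lambda>t. A (w t) $ k $ l) \<longlongrightarrow> A v $ k $ l) F" for k l
    unfolding A_def by (auto intro!: tendsto_intros lim)
  have "((\<lambda>t. det (A (w t))) \<longlongrightarrow> det (A v)) F"
    unfolding det_def by (intro tendsto_intros entries)
  then have "\<forall>\<^sub>F t in F. det (A (w t)) \<noteq> 0"
    by (rule tendsto_imp_eventually_ne) (simp add: \<open>A v = mat 1\<close>)
  then show ?thesis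
  proof (rule eventually_mono)
    fix t assume "det (A (w t)) \<noteq> 0"
    then have "\<exists>B. B ** A (w t) = mat 1"
      by (simp add: invertible_det_nz flip: invertible_left_inverse)
    then have "vec.span (rows (A (w t))) = UNIV"
      by (simp add: matrix_left_invertible_span_rows_gen)
    moreover have row: "row k (A (w t)) = (\<Sum>i\<in>I. c k i *s w t i)" for k
      by (simp add: row_def A_def vec_eq_iff)
    have "row k (A (w t)) \<in> vec.span (w t ` I)" for k
      unfolding row by (intro vec.span_sum vec.span_scale vec.span_base imageI)
    then have "rows (A (w t)) \<subseteq> vec.span (w t ` I)"
      by (auto simp: rows_def)
    ultimately show "vec.span (w t ` I) = UNIV"
      using vec.span_minimal[of "rows (A (w t))" "vec.span (w t ` I)"] by auto
  qed
qed

section \<open>Outer products\<close>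

locale conjugation =
  fixes cj :: "'a::{real_normed_field, euclidean_space} \<Rightarrow> 'a"
  assumes linear_cj: "linear cj" and cj_1: "cj 1 = 1"
begin

lemma tendsto_outer_product:
  assumes "(f \<longlongrightarrow> v) F"
  shows "((\<lambda>t. outer_product cj (f t)) \<longlongrightarrow> outer_product cj v) F"
  unfolding outer_product_def
  by (intro vec_tendstoI)
    (auto intro!: tendsto_intros assms
      bounded_linear.tendsto[OF linear_linear[THEN iffD2, OF linear_cj]])

lemma outer_product_scaleR: "outer_product cj (c *\<^sub>R v) = c\<^sup>2 *\<^sub>R outer_product cj v"
  by (simp add: outer_product_def vec_eq_iff linear_scale[OF linear_cj] power2_eq_square)

lemma parallelogram_outer_product:
  "outer_product cj (v + w) + outer_product cj (v - w)
    = 2 *\<^sub>R outer_product cj v + 2 *\<^sub>R outer_product cj w"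
  by (simp add: outer_product_def vec_eq_iff linear_add[OF linear_cj] linear_diff[OF linear_cj]
      algebra_simps scaleR_2)

text \<open>
  Polarization: for \<open>v = A\<^sub>i\<^sub>j e\<^sub>i\<close> and \<open>w = e\<^sub>j\<close> the difference
  \<open>(v + w) (v + w)\<^sup>* - v v\<^sup>* - w w\<^sup>*\<close> is \<open>A\<^sub>i\<^sub>j E\<^sub>i\<^sub>j\<close> plus its adjoint,
  where \<open>E\<^sub>i\<^sub>j\<close> is the matrix unit. For self-adjoint \<open>A\<close> these
  differences add up to \<open>2 A\<close> over all \<open>i\<close> and \<open>j\<close>, the diagonal included.
\<close>

lemma sym_matrices_subset_span_outer_products:
  "sym_matrices cj \<subseteq> span (range (outer_product cj :: 'a ^ 'n \<Rightarrow> _))"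
proof
  fix A :: "'a ^ 'n ^ 'n" assume "A \<in> sym_matrices cj"
  then have A: "cj (A $ l $ k) = A $ k $ l" for k l
    by (auto simp: sym_matrices_def adjoint_matrix_def vec_eq_iff)
  define cross where "cross i j = outer_product cj (axis i (A $ i $ j) + axis j 1)
      - outer_product cj (axis i (A $ i $ j)) - outer_product cj (axis j 1)" for i j
  have entry: "cross i j $ k $ l = (if i = k then if j = l then A $ i $ j else 0 else 0)
      + (if i = l then if j = k then cj (A $ i $ j) else 0 else 0)" for i j k l
    by (auto simp: cross_def outer_product_def axis_def linear_add[OF linear_cj] cj_1
        linear_0[OF linear_cj] algebra_simps)
  have inner: "(\<Sum>j\<in>UNIV. if i = k then if j = l then x j else 0 else 0)
      = (if i = k then x l else 0)" for x :: "'n \<Rightarrow> 'a" and i k l :: 'n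
    by (cases "i = k") simp_all
  have "(\<Sum>i\<in>UNIV. \<Sum>j\<in>UNIV. cross i j) $ k $ l = A $ k $ l + cj (A $ l $ k)" for k l
    by (simp only: sum_component entry sum.distrib inner) simp
  then have "(1/2) *\<^sub>R (\<Sum>i\<in>UNIV. \<Sum>j\<in>UNIV. cross i j) = A"
    by (simp add: vec_eq_iff A scaleR_2[symmetric])
  moreover have "(1/2) *\<^sub>R (\<Sum>i\<in>UNIV. \<Sum>j\<in>UNIV. cross i j) \<in> span (range (outer_product cj))"
    unfolding cross_def
    by (intro span_scale span_sum span_diff span_base rangeI)
  ultimately show "A \<in> span (range (outer_product cj))" by simp
qed

text \<open>
  The outer products of the vectors in a small piece of the sphere already span all self-adjoint
  matrices: \<open>w w\<^sup>*\<close> is a second difference of the quadratic map \<open>u \<mapsto> u u\<^sup>*\<close> at \<open>\<phi>\<close>.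
\<close>

lemma sym_matrices_subset_if_local_outer_products:
  fixes \<phi> :: "'a ^ 'n"
  assumes "subspace S" "norm \<phi> = 1" "e > 0"
    and S: "\<And>u. norm u = 1 \<Longrightarrow> norm (u - \<phi>) < e \<Longrightarrow> outer_product cj u \<in> S"
  shows "sym_matrices cj \<subseteq> S"
proof -
  have "outer_product cj w \<in> S" for w
  proof -
    have near: "\<forall>\<^sub>F t in at_right 0. outer_product cj (\<phi> + t *\<^sub>R x) \<in> S" for x
    proof -
      have lim: "((\<lambda>t. \<phi> + t *\<^sub>R x) \<longlongrightarrow> \<phi>) (at_right 0)"
        by (auto intro!: tendsto_eq_intros)
      have "\<phi> \<noteq> 0" using assms(2) by auto
      \<comment> \<open>\<open>sgn\<close> projects onto the unit sphere, where the hypothesis on \<open>S\<close> can be applied.\<close>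
      have "((\<lambda>t. sgn (\<phi> + t *\<^sub>R x)) \<longlongrightarrow> sgn \<phi>) (at_right 0)"
        by (rule tendsto_sgn[OF lim \<open>\<phi> \<noteq> 0\<close>])
      then have "((\<lambda>t. norm (sgn (\<phi> + t *\<^sub>R x) - \<phi>)) \<longlongrightarrow> 0) (at_right 0)"
        using assms(2) by (simp add: sgn_div_norm LIM_zero tendsto_norm_zero)
      then have "\<forall>\<^sub>F t in at_right 0. norm (sgn (\<phi> + t *\<^sub>R x) - \<phi>) < e"
        using \<open>e > 0\<close> by (rule order_tendstoD)
      moreover have "\<forall>\<^sub>F t in at_right 0. \<phi> + t *\<^sub>R x \<noteq> 0"
        using lim \<open>\<phi> \<noteq> 0\<close> by (rule tendsto_imp_eventually_ne)
      ultimately show ?thesis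
      proof eventually_elim
        case (elim t)
        let ?y = "\<phi> + t *\<^sub>R x"
        have "outer_product cj (sgn ?y) \<in> S"
          using elim by (intro S) (auto simp: norm_sgn)
        then have "outer_product cj (norm ?y *\<^sub>R sgn ?y) \<in> S"
          unfolding outer_product_scaleR by (rule subspace_scale[OF \<open>subspace S\<close>])
        then show ?case
          using elim by (simp add: sgn_div_norm)
      qed
    qed
    have "\<forall>\<^sub>F t in at_right 0. t > 0 \<and> outer_product cj (\<phi> + t *\<^sub>R w) \<in> S
        \<and> outer_product cj (\<phi> + t *\<^sub>R (- w)) \<in> S"
      by (intro eventually_conj near eventually_at_right_less)
    then obtain t where "t > 0 \<and> outer_product cj (\<phi> + t *\<^sub>R w) \<in> S
        \<and> outer_product cj (\<phi> + t *\<^sub>R (- w)) \<in> S"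
      using eventually_happens'[OF trivial_limit_at_right_real] by blast
    then have "t > 0" and plus: "outer_product cj (\<phi> + t *\<^sub>R w) \<in> S"
        and minus: "outer_product cj (\<phi> - t *\<^sub>R w) \<in> S"
      by simp_all
    have "outer_product cj \<phi> \<in> S"
      using assms(2,3) by (intro S) auto
    moreover have "(2 * t\<^sup>2) *\<^sub>R outer_product cj w = outer_product cj (\<phi> + t *\<^sub>R w)
        + outer_product cj (\<phi> - t *\<^sub>R w) - 2 *\<^sub>R outer_product cj \<phi>"
      by (simp add: parallelogram_outer_product outer_product_scaleR)
    ultimately have "(2 * t\<^sup>2) *\<^sub>R outer_product cj w \<in> S"
      using plus minus \<open>subspace S\<close>
      by (simp add: subspace_add subspace_diff subspace_scale)
    then have "(1 / (2 * t\<^sup>2)) *\<^sub>R ((2 * t\<^sup>2) *\<^sub>R outer_product cj w) \<in> S"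
      by (rule subspace_scale[OF \<open>subspace S\<close>])
    then show ?thesis
      using \<open>t > 0\<close> by simp
  qed
  then have "span (range (outer_product cj :: 'a ^ 'n \<Rightarrow> _)) \<subseteq> S"
    using \<open>subspace S\<close> by (intro span_minimal) auto
  then show ?thesis
    using sym_matrices_subset_span_outer_products by blast
qed

text \<open>
  The vectors are replaced one at a time. A span of \<open>m\<close> matrices is too small to contain all
  self-adjoint matrices when \<open>m\<close> is below their dimension, hence it misses the outer product of
  some unit vector arbitrarily close to the next one.
\<close>

lemma exists_close_independent_outer_products:
  fixes \<Phi> :: "nat \<Rightarrow> 'a ^ 'n"
  assumes "m \<le> dim (sym_matrices cj :: ('a ^ 'n ^ 'n) set)" "e > 0"
    and "\<forall>i\<in>{1..m}. norm (\<Phi> i) = 1"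
  shows "\<exists>\<Psi>. (\<forall>i\<in>{1..m}. norm (\<Psi> i) = 1 \<and> norm (\<Psi> i - \<Phi> i) < e) \<and>
    independent_family {1..m} (\<lambda>i. outer_product cj (\<Psi> i))"
  using assms(1,3)
proof (induction m)
  case 0
  then show ?case by (simp add: independent_family_def independent_empty)
next
  case (Suc m)
  then obtain \<Psi> where close: "\<And>i. i \<in> {1..m} \<Longrightarrow> norm (\<Psi> i) = 1 \<and> norm (\<Psi> i - \<Phi> i) < e"
      and ind: "independent_family {1..m} (\<lambda>i. outer_product cj (\<Psi> i))"
    by force
  define S where "S = span ((\<lambda>i. outer_product cj (\<Psi> i)) ` {1..m})"
  have "dim S \<le> card ((\<lambda>i. outer_product cj (\<Psi> i)) ` {1..m})"
    unfolding S_def dim_span by (rule dim_le_card') simp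
  also have "\<dots> \<le> m"
    using card_image_le[of "{1..m}"] by fastforce
  finally have "\<not> sym_matrices cj \<subseteq> S"
    using Suc.prems(1) dim_subset[of "sym_matrices cj" S] by linarith
  then obtain u where u: "norm u = 1" "norm (u - \<Phi> (Suc m)) < e" "outer_product cj u \<notin> S"
    using sym_matrices_subset_if_local_outer_products[of S "\<Phi> (Suc m)" e] Suc.prems(2) \<open>e > 0\<close>
    by (auto simp: S_def)
  define \<Psi>' where "\<Psi>' = \<Psi>(Suc m := u)"
  have eq: "outer_product cj (\<Psi>' i) = outer_product cj (\<Psi> i)" if "i \<in> {1..m}" for i
    using that by (auto simp: \<Psi>'_def)
  have image: "(\<lambda>i. outer_product cj (\<Psi>' i)) ` {1..m} = (\<lambda>i. outer_product cj (\<Psi> i)) ` {1..m}"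
    by (rule image_cong[OF refl eq])
  have "independent_family (insert (Suc m) {1..m}) (\<lambda>i. outer_product cj (\<Psi>' i))"
  proof (rule independent_family_insert)
    have "independent_family {1..m} (\<lambda>i. outer_product cj (\<Psi>' i))
        \<longleftrightarrow> independent_family {1..m} (\<lambda>i. outer_product cj (\<Psi> i))"
      by (rule independent_family_cong) (rule eq)
    with ind show "independent_family {1..m} (\<lambda>i. outer_product cj (\<Psi>' i))"
      by (simp only:)
    show "outer_product cj (\<Psi>' (Suc m)) \<notin> span ((\<lambda>i. outer_product cj (\<Psi>' i)) ` {1..m})"
      using u(3) unfolding image S_def by (simp add: \<Psi>'_def)
  qed
  then have "independent_family {1..Suc m} (\<lambda>i. outer_product cj (\<Psi>' i))"
    by (simp add: atLeastAtMostSuc_conv)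
  moreover have "\<forall>i\<in>{1..Suc m}. norm (\<Psi>' i) = 1 \<and> norm (\<Psi>' i - \<Phi> i) < e"
    using close u by (auto simp: \<Psi>'_def le_Suc_eq)
  ultimately show ?case by blast
qed

end

section \<open>Openness and density\<close>

lemma norm_diff_le_frame_dist: "i \<in> {1..M} \<Longrightarrow> norm (\<Psi> i - \<Phi> i) \<le> frame_dist M \<Phi> \<Psi>"
  using member_le_L2_set[of "{1..M}" i "\<lambda>i. norm (\<Phi> i - \<Psi> i)"]
  by (simp add: frame_dist_def L2_set_def norm_minus_commute)

context conjugation
begin

lemma openin_independent_outer_frames:
  "openin (frame_topology M) (independent_outer_frames cj M :: (nat \<Rightarrow> 'a ^ 'n) set)"
proof -
  interpret Metric_space "unit_norm_frames M :: (nat \<Rightarrow> 'a ^ 'n) set" "frame_dist M"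
    by (rule Metric_space_unit_norm_frames)
  show ?thesis
    unfolding openin_mtopology
  proof (intro conjI allI impI)
    show "independent_outer_frames cj M \<subseteq> (unit_norm_frames M :: (nat \<Rightarrow> 'a ^ 'n) set)"
      by (auto simp: independent_outer_frames_def)
    fix \<Phi> :: "nat \<Rightarrow> 'a ^ 'n"
    assume \<Phi>: "\<Phi> \<in> independent_outer_frames cj M"
    \<comment> \<open>the filter of the neighbourhoods of \<open>\<Phi>\<close> with respect to the frame distance\<close>
    define F where "F = filtercomap (frame_dist M \<Phi>) (nhds 0)"
    have "((\<lambda>\<Psi>. \<Psi> i) \<longlongrightarrow> \<Phi> i) F" if "i \<in> {1..M}" for i
    proof (rule metric_tendsto_imp_tendsto)
      show "(frame_dist M \<Phi> \<longlongrightarrow> 0) F"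
        unfolding F_def by (rule filterlim_filtercomap)
      show "\<forall>\<^sub>F \<Psi> in F. dist (\<Psi> i) (\<Phi> i) \<le> dist (frame_dist M \<Phi> \<Psi>) 0"
        by (intro always_eventually allI) (simp add: dist_norm norm_diff_le_frame_dist[OF that])
    qed
    then have "\<forall>\<^sub>F \<Psi> in F. independent_family {1..M} (\<lambda>i. outer_product cj (\<Psi> i))"
      using \<Phi> by (intro eventually_independent_family[where v = "\<lambda>i. outer_product cj (\<Phi> i)"]
          tendsto_outer_product) (auto simp: independent_outer_frames_def)
    then obtain Q where "eventually Q (nhds 0)"
        "\<And>\<Psi>. Q (frame_dist M \<Phi> \<Psi>) \<Longrightarrow> independent_family {1..M} (\<lambda>i. outer_product cj (\<Psi> i))"
      by (auto simp: F_def eventually_filtercomap)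
    then obtain r where "r > 0"
        "\<And>\<Psi>. \<bar>frame_dist M \<Phi> \<Psi>\<bar> < r \<Longrightarrow> independent_family {1..M} (\<lambda>i. outer_product cj (\<Psi> i))"
      by (auto simp: eventually_nhds_metric)
    then show "\<exists>r>0. mball \<Phi> r \<subseteq> independent_outer_frames cj M"
      by (intro exI[of _ r]) (auto simp: independent_outer_frames_def)
  qed
qed

lemma closure_of_independent_outer_frames:
  assumes M: "M \<le> dim (sym_matrices cj :: ('a ^ 'n ^ 'n) set)"
  shows "frame_topology M closure_of (independent_outer_frames cj M :: (nat \<Rightarrow> 'a ^ 'n) set)
    = unit_norm_frames M"
proof -
  interpret Metric_space "unit_norm_frames M :: (nat \<Rightarrow> 'a ^ 'n) set" "frame_dist M"
    by (rule Metric_space_unit_norm_frames)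
  have "\<exists>\<Psi>\<in>independent_outer_frames cj M. \<Psi> \<in> mball \<Phi> r"
    if \<Phi>: "\<Phi> \<in> unit_norm_frames M" and "r > 0" for \<Phi> :: "nat \<Rightarrow> 'a ^ 'n" and r
  proof -
    have unit: "\<forall>i\<in>{1..M}. norm (\<Phi> i) = 1" and span: "vec.span (\<Phi> ` {1..M}) = UNIV"
      using \<Phi> by (auto simp: unit_norm_frames_def is_frame_def)
    have "\<exists>\<Psi>. (\<forall>i\<in>{1..M}. norm (\<Psi> i) = 1 \<and> norm (\<Psi> i - \<Phi> i) < inverse (real (Suc n))) \<and>
        independent_family {1..M} (\<lambda>i. outer_product cj (\<Psi> i))" for n
      by (rule exists_close_independent_outer_products[OF M _ unit]) simp
    then obtain \<Psi> where \<Psi>: "\<And>n i. i \<in> {1..M} \<Longrightarrow> norm (\<Psi> n i) = 1"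
        "\<And>n i. i \<in> {1..M} \<Longrightarrow> norm (\<Psi> n i - \<Phi> i) < inverse (real (Suc n))"
        "\<And>n. independent_family {1..M} (\<lambda>i. outer_product cj (\<Psi> n i))"
      by metis
    \<comment> \<open>A frame takes the default value outside its index set.\<close>
    define \<Theta> where "\<Theta> n = restrict (\<Psi> n) {1..M}" for n
    have lim: "(\<lambda>n. \<Theta> n i) \<longlonglongrightarrow> \<Phi> i" if "i \<in> {1..M}" for i
    proof (rule LIM_zero_cancel, rule LIMSEQ_norm_0)
      show "norm (\<Theta> n i - \<Phi> i) < 1 / real (Suc n)" for n
        using \<Psi>(2)[OF that, of n] that by (simp add: \<Theta>_def inverse_eq_divide)
    qed
    have "(\<lambda>n. frame_dist M \<Phi> (\<Theta> n)) \<longlonglongrightarrow> frame_dist M \<Phi> \<Phi>"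
      unfolding frame_dist_def by (intro tendsto_intros lim)
    then have "\<forall>\<^sub>F n in sequentially. frame_dist M \<Phi> (\<Theta> n) < r"
      using \<open>r > 0\<close> by (intro order_tendstoD(2)) (auto simp: frame_dist_def)
    moreover have "\<forall>\<^sub>F n in sequentially. vec.span (\<Theta> n ` {1..M}) = UNIV"
      by (rule eventually_spanning[OF _ span lim]) simp_all
    ultimately have "\<forall>\<^sub>F n in sequentially.
        frame_dist M \<Phi> (\<Theta> n) < r \<and> vec.span (\<Theta> n ` {1..M}) = UNIV"
      by (rule eventually_conj)
    then obtain n where n: "frame_dist M \<Phi> (\<Theta> n) < r" "vec.span (\<Theta> n ` {1..M}) = UNIV"
      using eventually_happens'[OF sequentially_bot] by blast
    have "\<Theta> n \<in> unit_norm_frames M"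
      using n(2) \<Psi>(1) by (simp add: unit_norm_frames_def is_frame_def \<Theta>_def)
    moreover have "independent_family {1..M} (\<lambda>i. outer_product cj (\<Theta> n i))"
      using \<Psi>(3)[of n] by (subst independent_family_cong) (auto simp: \<Theta>_def)
    ultimately show ?thesis
      using n(1) \<Phi> by (intro bexI[of _ "\<Theta> n"]) (auto simp: independent_outer_frames_def)
  qed
  then show ?thesis
    unfolding metric_closure_of by blast
qed

end

interpretation real_conj: conjugation "id :: real \<Rightarrow> real"
  by unfold_locales simp_all

interpretation complex_conj: conjugation cnj
  by unfold_locales simp_all

theorem theorem8p6:
  fixes M :: nat
  shows "(M \<le> dim (sym_matrices id :: (real ^ 'n ^ 'n) set) \<longrightarrow>
      openin (frame_topology M) (independent_outer_frames id M :: (nat \<Rightarrow> real ^ 'n) set) \<and>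
      frame_topology M closure_of (independent_outer_frames id M :: (nat \<Rightarrow> real ^ 'n) set)
        = unit_norm_frames M) \<and>
    (M \<le> dim (sym_matrices cnj :: (complex ^ 'n ^ 'n) set) \<longrightarrow>
      openin (frame_topology M) (independent_outer_frames cnj M :: (nat \<Rightarrow> complex ^ 'n) set) \<and>
      frame_topology M closure_of (independent_outer_frames cnj M :: (nat \<Rightarrow> complex ^ 'n) set)
        = unit_norm_frames M)"
  by (intro conjI impI
      real_conj.openin_independent_outer_frames real_conj.closure_of_independent_outer_frames
      complex_conj.openin_independent_outer_frames complex_conj.closure_of_independent_outer_frames)

end
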